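(* Let $(\Omega,U,V)$ be a collective model (feasible set of allocations $\Omega$, utility functions $U(q^a,Q)$ and $V(q^b,Q)$) satisfying the assumptions Feasible Allocations, Utility Functions, Transferability, Concave Cardinal Representation and Vital Goods listed in the context. Then the strict utility possibility set $$\mathcal{H}=\{(u,v)\in\mathbb{R}^2:\exists (q^a,q^b,Q)\in\Omega,\ u=U(q^a,Q),\ v=V(q^b,Q)\}$$ is a proper bargaining set, and any point $(u,v)$ on the boundary of $\mathcal{H}$ is strongly Pareto efficient.
   Context: Setting. A pair (a man and a woman) chooses an allocation $\omega=(q^a,q^b,Q)$ from a nonempty feasible set $\Omega$ of vectors with nonnegative coordinates, where $q^a$ and $q^b$ are the (finite-dimensional) vectors of private goods consumed by the man and the woman and $Q$ is the (finite-dimensional) vector of public goods. The man's utility is $U(q^a,Q)$, the woman's is $V(q^b,Q)$. Utilities take values in $\mathbb{R}\cup\{-\infty\}$ (as, e.g., logarithmic utilities do at zero consumption), and $\Omega$ contains at least one allocation at which both utilities are finite. For a good $k$, $q_{-k}$ denotes the vector of the remaining private goods. Assumptions. - Feasible Allocations: $\Omega$ is compact and convex. - Utility Functions: $U$ and $V$ are upper semicontinuous and bounded above on $\Omega$, and strictly increasing (nondecreasing in each argument, and strictly increasing in each argument wherever finite). - Transferability: if $(q^a,q^b,Q)\in\Omega$ and $q^a_k>0$ for some private good $k$, then for any $q^{a\prime}$ with $q^{a\prime}_{-k}=q^a_{-k}$, $q^{a\prime}_k<q^a_k$ and $(q^{a\prime},q^b,Q)\in\Omega$, there are a private good $l$ and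 a $q^{b\prime}$ such that $q^{b\prime}_{-l}=q^b_{-l}$, $q^{b\prime}_l>q^b_l$ and $(q^{a\prime},q^{b\prime},Q)\in\Omega$; and the same holds with the roles of $a$ and $b$ exchanged. - Concave Cardinal Representation: $U$ and $V$ are concave, and strictly concave on the set where they are finite (in particular strictly quasi-concave there). - Vital Goods: there are two private goods, with quantities $q^a_1$ and $q^b_1$, such that (i) $\lim_{q^a_1\to0^+}U(q^a,Q)=-\infty$ and $\lim_{q^b_1\to0^+}V(q^b,Q)=-\infty$; (ii) for any $(q^a,q^b,Q)\in\Omega$, $((q_1^{a\prime},q^a_{-1}),(q_1^{b\prime},q^b_{-1}),Q)\in\Omega$ whenever $0\le q_1^{a\prime}\leq q^a_1$ and $0\le q_1^{b\prime}\leq q^b_1$. Definitions. A set $\mathcal{F}\subset\mathbb{R}^2$ is a proper bargaining set if: (i) $\mathcal{F}$ is closed and nonempty; (ii) $\mathcal{F}$ is lower comprehensive: if $(u,v)\in\mathcal{F}$, $u'\le u$ and $v'\le v$, then $(u',v')\in\mathcal{F}$; (iii) $\mathcal{F}$ is bounded above: if $u_n\to+\infty$ and $v_n$ is bounded below, then there is $N$ such that $(u_n,v_n)\notin\mathcal{F}$ for all $n\ge N$, and similarly if $u_n$ is bounded below and $v_n\to+\infty$. A point $(u,v)\in\mathcal{H}$ is strongly Pareto efficient if there is no $(u',v')\in\mathcal{H}$ with $u'\ge u$, $v'\ge v$ and at least one strict inequality.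
   Formalization: The limit in Vital Goods (i) is read as divergence through finite values: from any bundle with finite utility, varying the vital good reaches arbitrarily low finite utilities; without this, U may jump from a finite value to −∞ and the claim fails. *)

theory Defs
  imports "HOL-Analysis.Analysis"
begin

text \<open>
  A bundle is a pair \<open>(q, Q)\<close> of private and public consumption, an allocation a triple
  \<open>(qa, qb, Q)\<close>. The consumption set is the nonnegative orthant; the order on vectors
  and on pairs of vectors is componentwise. Utilities are \<open>ereal\<close>-valued and never \<open>\<infinity>\<close>
  on the orthant.
\<close>

type_synonym ('n, 'm) consumption = "(real ^ 'n) \<times> (real ^ 'm)"
type_synonym ('n, 'm) allocation = "(real ^ 'n) \<times> (real ^ 'n) \<times> (real ^ 'm)"

definition set_coord :: "real ^ 'n \<Rightarrow> 'n \<Rightarrow> real \<Rightarrow> real ^ 'n" where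
  "set_coord q k x = (\<chi> j. if j = k then x else q $ j)"

definition collective_model ::
  "('n::finite, 'm::finite) allocation set \<Rightarrow> (('n, 'm) consumption \<Rightarrow> ereal)
     \<Rightarrow> (('n, 'm) consumption \<Rightarrow> ereal) \<Rightarrow> bool" where
  "collective_model \<Omega> U V \<longleftrightarrow>
     (\<forall>\<omega>\<in>\<Omega>. 0 \<le> \<omega>) \<and>
     (\<forall>z\<ge>0. U z \<noteq> \<infinity>) \<and> (\<forall>z\<ge>0. V z \<noteq> \<infinity>) \<and>
     (\<exists>(qa, qb, Q)\<in>\<Omega>. U (qa, Q) \<noteq> -\<infinity> \<and> V (qb, Q) \<noteq> -\<infinity>)"

definition feasible_allocations :: "('n::finite, 'm::finite) allocation set \<Rightarrow> bool" where
  "feasible_allocations \<Omega> \<longleftrightarrow> compact \<Omega> \<and> convex \<Omega>"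

definition usc_on :: "'a::topological_space set \<Rightarrow> ('a \<Rightarrow> ereal) \<Rightarrow> bool" where
  "usc_on S f \<longleftrightarrow> (\<forall>x\<in>S. \<forall>c > f x. \<forall>\<^sub>F y in at x within S. f y < c)"

definition bounded_above_on :: "'a set \<Rightarrow> ('a \<Rightarrow> ereal) \<Rightarrow> bool" where
  "bounded_above_on S f \<longleftrightarrow> (\<exists>M::real. \<forall>x\<in>S. f x \<le> ereal M)"

definition strictly_increasing_utility :: "(('n::finite, 'm::finite) consumption \<Rightarrow> ereal) \<Rightarrow> bool" where
  "strictly_increasing_utility W \<longleftrightarrow>
     (\<forall>q\<ge>0. \<forall>Q\<ge>0.
        (\<forall>k. \<forall>x > q $ k. W (q, Q) \<le> W (set_coord q k x, Q) \<and>
           (W (q, Q) \<noteq> -\<infinity> \<longrightarrow> W (q, Q) < W (set_coord q k x, Q))) \<and>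
        (\<forall>k. \<forall>x > Q $ k. W (q, Q) \<le> W (q, set_coord Q k x) \<and>
           (W (q, Q) \<noteq> -\<infinity> \<longrightarrow> W (q, Q) < W (q, set_coord Q k x))))"

definition utility_functions ::
  "('n::finite, 'm::finite) allocation set \<Rightarrow> (('n, 'm) consumption \<Rightarrow> ereal)
     \<Rightarrow> (('n, 'm) consumption \<Rightarrow> ereal) \<Rightarrow> bool" where
  "utility_functions \<Omega> U V \<longleftrightarrow>
     usc_on \<Omega> (\<lambda>(qa, qb, Q). U (qa, Q)) \<and> usc_on \<Omega> (\<lambda>(qa, qb, Q). V (qb, Q)) \<and>
     bounded_above_on \<Omega> (\<lambda>(qa, qb, Q). U (qa, Q)) \<and>
     bounded_above_on \<Omega> (\<lambda>(qa, qb, Q). V (qb, Q)) \<and>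
     strictly_increasing_utility U \<and> strictly_increasing_utility V"

definition transferability :: "('n::finite, 'm::finite) allocation set \<Rightarrow> bool" where
  "transferability \<Omega> \<longleftrightarrow>
     (\<forall>qa qb Q k x. (qa, qb, Q) \<in> \<Omega> \<and> qa $ k > 0 \<and> x < qa $ k \<and> (set_coord qa k x, qb, Q) \<in> \<Omega> \<longrightarrow>
        (\<exists>l y. y > qb $ l \<and> (set_coord qa k x, set_coord qb l y, Q) \<in> \<Omega>)) \<and>
     (\<forall>qa qb Q k x. (qa, qb, Q) \<in> \<Omega> \<and> qb $ k > 0 \<and> x < qb $ k \<and> (qa, set_coord qb k x, Q) \<in> \<Omega> \<longrightarrow>
        (\<exists>l y. y > qa $ l \<and> (set_coord qa l y, set_coord qb k x, Q) \<in> \<Omega>))"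

text \<open>
  Values \<open>-\<infinity>\<close> are allowed, so the inequalities are in \<open>ereal\<close>; no \<open>\<infinity> - \<infinity>\<close> arises because
  \<open>\<infinity>\<close> is excluded.
\<close>

definition ereal_concave_on :: "'a::real_vector set \<Rightarrow> ('a \<Rightarrow> ereal) \<Rightarrow> bool" where
  "ereal_concave_on S f \<longleftrightarrow> convex S \<and>
     (\<forall>x\<in>S. \<forall>y\<in>S. \<forall>t. 0 < t \<and> t < 1 \<longrightarrow>
        ereal (1 - t) * f x + ereal t * f y \<le> f ((1 - t) *\<^sub>R x + t *\<^sub>R y))"

definition strictly_concave_where_finite :: "'a::real_vector set \<Rightarrow> ('a \<Rightarrow> ereal) \<Rightarrow> bool" where
  "strictly_concave_where_finite S f \<longleftrightarrow>
     (\<forall>x\<in>S. \<forall>y\<in>S. \<forall>t. x \<noteq> y \<and> \<bar>f x\<bar> \<noteq> \<infinity> \<and> \<bar>f y\<bar> \<noteq> \<infinity> \<and> 0 < t \<and> t < 1 \<longrightarrow>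
        ereal (1 - t) * f x + ereal t * f y < f ((1 - t) *\<^sub>R x + t *\<^sub>R y))"

definition concave_cardinal_representation ::
  "(('n::finite, 'm::finite) consumption \<Rightarrow> ereal) \<Rightarrow> (('n, 'm) consumption \<Rightarrow> ereal) \<Rightarrow> bool" where
  "concave_cardinal_representation U V \<longleftrightarrow>
     ereal_concave_on {z. 0 \<le> z} U \<and> strictly_concave_where_finite {z. 0 \<le> z} U \<and>
     ereal_concave_on {z. 0 \<le> z} V \<and> strictly_concave_where_finite {z. 0 \<le> z} V"

text \<open>
  The limit \<open>-\<infinity>\<close> is a divergence through finite values: from a bundle with finite utility,
  lowering good \<open>k\<close> reaches arbitrarily low finite utilities. The second conjunct says
  this. The first alone would also admit a utility such as \<open>ln q\<close> for \<open>q \<ge> 1\<close> and \<open>-\<infinity>\<close>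
  for \<open>q < 1\<close>, which is concave and upper semicontinuous but jumps from \<open>0\<close> to \<open>-\<infinity>\<close>,
  so that the utility possibility set is not lower comprehensive.
\<close>

definition vital_for :: "'n \<Rightarrow> (('n::finite, 'm::finite) consumption \<Rightarrow> ereal) \<Rightarrow> bool" where
  "vital_for k W \<longleftrightarrow>
     (\<forall>q\<ge>0. \<forall>Q\<ge>0.
        ((\<lambda>t. W (set_coord q k t, Q)) \<longlongrightarrow> -\<infinity>) (at_right 0) \<and>
        (W (q, Q) \<noteq> -\<infinity> \<longrightarrow>
           (\<forall>M::real. \<exists>t>0. -\<infinity> < W (set_coord q k t, Q) \<and> W (set_coord q k t, Q) < ereal M)))"

text \<open>The two vital goods may be the same commodity or different ones.\<close>

definition vital_goods ::
  "('n::finite, 'm::finite) allocation set \<Rightarrow> (('n, 'm) consumption \<Rightarrow> ereal)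
     \<Rightarrow> (('n, 'm) consumption \<Rightarrow> ereal) \<Rightarrow> bool" where
  "vital_goods \<Omega> U V \<longleftrightarrow>
     (\<exists>i j. vital_for i U \<and> vital_for j V \<and>
        (\<forall>(qa, qb, Q)\<in>\<Omega>. \<forall>x y. 0 \<le> x \<and> x \<le> qa $ i \<and> 0 \<le> y \<and> y \<le> qb $ j \<longrightarrow>
           (set_coord qa i x, set_coord qb j y, Q) \<in> \<Omega>))"

definition strict_utility_possibility_set ::
  "('n::finite, 'm::finite) allocation set \<Rightarrow> (('n, 'm) consumption \<Rightarrow> ereal)
     \<Rightarrow> (('n, 'm) consumption \<Rightarrow> ereal) \<Rightarrow> (real \<times> real) set" where
  "strict_utility_possibility_set \<Omega> U V =
     {(u, v). \<exists>(qa, qb, Q)\<in>\<Omega>. ereal u = U (qa, Q) \<and> ereal v = V (qb, Q)}"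

definition lower_comprehensive :: "(real \<times> real) set \<Rightarrow> bool" where
  "lower_comprehensive F \<longleftrightarrow>
     (\<forall>u v u' v'. (u, v) \<in> F \<and> u' \<le> u \<and> v' \<le> v \<longrightarrow> (u', v') \<in> F)"

definition bargaining_bounded_above :: "(real \<times> real) set \<Rightarrow> bool" where
  "bargaining_bounded_above F \<longleftrightarrow>
     (\<forall>u v :: nat \<Rightarrow> real.
        (filterlim u at_top sequentially \<and> bdd_below (range v) \<longrightarrow> (\<exists>N. \<forall>n\<ge>N. (u n, v n) \<notin> F)) \<and>
        (bdd_below (range u) \<and> filterlim v at_top sequentially \<longrightarrow> (\<exists>N. \<forall>n\<ge>N. (u n, v n) \<notin> F)))"

definition proper_bargaining_set :: "(real \<times> real) set \<Rightarrow> bool" where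
  "proper_bargaining_set F \<longleftrightarrow>
     closed F \<and> F \<noteq> {} \<and> lower_comprehensive F \<and> bargaining_bounded_above F"

definition strongly_pareto_efficient :: "(real \<times> real) set \<Rightarrow> real \<times> real \<Rightarrow> bool" where
  "strongly_pareto_efficient H p \<longleftrightarrow> p \<in> H \<and>
     \<not> (\<exists>(u', v')\<in>H. u' \<ge> fst p \<and> v' \<ge> snd p \<and> (u' > fst p \<or> v' > snd p))"

end

theory Submission
  imports Defs
begin

text \<open>
  Along the vital good a utility is finite, concave and hence continuous, and unbounded below, so
  it attains every lower level. Therefore free disposal of the vital goods makes
  \<open>\<H>\<close> the set of pairs dominated by some feasible utility pair; compactness and upper
  semicontinuity then give closedness. If a boundary point were dominated with, say, a strictly
  higher \<open>u\<close>, giving up a little of the man's vital good would, by transferability, leave both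
  utilities strictly above the point, which would thus be interior.
\<close>

lemma set_coord_nth_self [simp]: "set_coord q k (q $ k) = q"
  by (simp add: set_coord_def vec_eq_iff)

lemma set_coord_overwrite [simp]: "set_coord (set_coord q k x) k y = set_coord q k y"
  by (simp add: set_coord_def vec_eq_iff)

lemma set_coord_nth [simp]: "set_coord q k x $ j = (if j = k then x else q $ j)"
  by (simp add: set_coord_def)

lemma set_coord_nonneg: "0 \<le> q \<Longrightarrow> 0 \<le> x \<Longrightarrow> 0 \<le> set_coord q k x"
  by (simp add: less_eq_vec_def)

text \<open>Varying one coordinate is affine, so concavity on the orthant restricts to concavity in
  the quantity of a single good.\<close>

lemma set_coord_convex_comb:
  "(1 - t) *\<^sub>R (set_coord q k x, Q) + t *\<^sub>R (set_coord q k y, Q)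
     = (set_coord q k ((1 - t) * x + t * y), Q)"
  by (simp add: vec_eq_iff algebra_simps)

lemma strictly_increasing_utility_mono:
  assumes "strictly_increasing_utility W" "0 \<le> q" "0 \<le> Q" "0 \<le> s" "s \<le> t"
  shows "W (set_coord q k s, Q) \<le> W (set_coord q k t, Q)"
proof (cases "s = t")
  case False
  with assms show ?thesis
    unfolding strictly_increasing_utility_def
    by (metis set_coord_nonneg set_coord_nth set_coord_overwrite order_le_less)
qed simp

lemma strictly_increasing_utility_strict:
  assumes "strictly_increasing_utility W" "0 \<le> q" "0 \<le> Q" "q $ k < x" "W (q, Q) \<noteq> -\<infinity>"
  shows "W (q, Q) < W (set_coord q k x, Q)"
  using assms unfolding strictly_increasing_utility_def by blast

text \<open>Intermediate value theorem in the quantity of good \<open>k\<close>: the vital good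
  provides a finite value below \<open>w'\<close>, and concavity provides continuity from there up
  to \<open>q $ k\<close>.\<close>

lemma vital_good_attains_lower_level:
  fixes W :: "('n::finite, 'm::finite) consumption \<Rightarrow> ereal"
  assumes fin: "\<forall>z\<ge>0. W z \<noteq> \<infinity>"
    and inc: "strictly_increasing_utility W"
    and conc: "ereal_concave_on {z. 0 \<le> z} W"
    and vital: "vital_for k W"
    and q: "0 \<le> q" and Q: "0 \<le> Q"
    and w: "W (q, Q) = ereal w" and le: "w' \<le> w"
  shows "\<exists>x. 0 < x \<and> x \<le> q $ k \<and> W (set_coord q k x, Q) = ereal w'"
proof -
  let ?f = "\<lambda>t. W (set_coord q k t, Q)"
  have mono: "?f s \<le> ?f t" if "0 \<le> s" "s \<le> t" for s t
    using strictly_increasing_utility_mono[OF inc q Q that] .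
  have ninf: "?f s \<noteq> \<infinity>" if "0 \<le> s" for s
    using fin that q Q by (auto simp: less_eq_prod_def set_coord_nonneg)
  have low: "\<exists>t>0. -\<infinity> < ?f t \<and> ?f t < ereal M" for M
    using vital q Q w unfolding vital_for_def by (metis MInfty_neq_ereal(1))
  obtain t where t: "0 < t" "-\<infinity> < ?f t" "?f t < ereal w'"
    using low by blast
  obtain r where r: "?f t = ereal r"
    using t by (cases "?f t") auto
  \<comment> \<open>A second, still lower finite point: it makes \<open>t\<close> interior to the
    ray \<open>{t0<..}\<close>, where monotonicity keeps the utility finite.\<close>
  obtain t0 where t0: "0 < t0" "-\<infinity> < ?f t0" "?f t0 < ?f t"
    using low[of r] r by auto
  have "t0 < t"
    using mono[of t t0] t0 t by force
  have "t < q $ k"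
  proof (rule ccontr)
    assume "\<not> t < q $ k"
    then have "?f (q $ k) \<le> ?f t"
      using mono[of "q $ k" t] q by (simp add: less_eq_vec_def)
    then have "ereal w \<le> ?f t" by (simp add: w)
    with t le show False
      by (metis ereal_less_eq(3) leD order_trans)
  qed
  let ?g = "\<lambda>s. real_of_ereal (?f s)"
  have real: "?f s = ereal (?g s)" if "s \<in> {t0<..}" for s
  proof -
    have "?f s \<noteq> -\<infinity>" "?f s \<noteq> \<infinity>"
      using mono[of t0 s] ninf[of s] t0 that by auto
    then show ?thesis by (cases "?f s") auto
  qed
  \<comment> \<open>A convex function is continuous on an open domain. The ray also extends beyond
    \<open>q $ k\<close>, so both ends of the interval from \<open>t\<close> to \<open>q $ k\<close>
    are interior to it.\<close>
  have "convex_on {t0<..} (\<lambda>s. - ?g s)"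
  proof (rule convex_onI)
    fix u x y :: real
    assume u: "0 < u" "u < 1" and xy: "x \<in> {t0<..}" "y \<in> {t0<..}"
    define z where "z = (1 - u) * x + u * y"
    have z: "z \<in> {t0<..}"
      using convexD_alt[OF convex_real_interval(3), of x t0 y u] u xy by (simp add: z_def)
    have "(set_coord q k x, Q) \<in> {z. 0 \<le> z}" "(set_coord q k y, Q) \<in> {z. 0 \<le> z}"
      using xy t0 q Q by (auto simp: less_eq_prod_def set_coord_nonneg)
    then have "ereal (1 - u) * ?f x + ereal u * ?f y \<le> ?f z"
      using conc u unfolding ereal_concave_on_def z_def set_coord_convex_comb[symmetric]
      by blast
    then have "(1 - u) * ?g x + u * ?g y \<le> ?g z"
      using real[OF xy(1)] real[OF xy(2)] real[OF z]
      by (metis ereal_less_eq(3) plus_ereal.simps(1) times_ereal.simps(1))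
    then show "- ?g ((1 - u) *\<^sub>R x + u *\<^sub>R y) \<le> (1 - u) * - ?g x + u * - ?g y"
      by (simp add: z_def)
  qed simp
  then have "continuous_on {t0<..} (\<lambda>s. - ?g s)"
    by (intro convex_on_continuous) auto
  then have "continuous_on {t0<..} ?g"
    using continuous_on_minus by fastforce
  then have "continuous_on {t..q $ k} ?g"
    by (rule continuous_on_subset) (use \<open>t0 < t\<close> in auto)
  moreover have "?g t \<le> w'" "w' \<le> ?g (q $ k)"
    using t r w le by auto
  ultimately obtain x where "t \<le> x" "x \<le> q $ k" "?g x = w'"
    using IVT'[of ?g t w' "q $ k"] \<open>t < q $ k\<close> by auto
  with real[of x] t \<open>t0 < t\<close> show ?thesis
    by (intro exI[of _ x]) auto
qed

text \<open>A level \<open>c\<close> strictly between \<open>f x\<close> and \<open>l\<close> would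
  eventually lie above \<open>f (X n)\<close> by upper semicontinuity, yet below \<open>a n\<close>.
  This carries lower bounds on utilities to a limit allocation.\<close>

lemma usc_on_ge_limit:
  fixes a :: "nat \<Rightarrow> real" and X :: "nat \<Rightarrow> 'a::topological_space"
  assumes usc: "usc_on S f" and X: "X \<longlonglongrightarrow> x" "\<And>n. X n \<in> S" and "x \<in> S"
    and a: "a \<longlonglongrightarrow> l" and le: "\<And>n. ereal (a n) \<le> f (X n)"
  shows "ereal l \<le> f x"
proof (rule ccontr)
  assume "\<not> ereal l \<le> f x"
  then obtain c where c: "f x < c" "c < ereal l"
    using dense not_le by metis
  \<comment> \<open>The filter in \<open>usc_on\<close> leaves out \<open>x\<close> itself; since
    \<open>f x < c\<close>, the full neighbourhood filter may be used, so that
    \<open>X n = x\<close> is allowed.\<close>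
  have "\<forall>\<^sub>F y in nhds x. y \<in> S \<longrightarrow> f y < c"
    using usc c \<open>x \<in> S\<close> unfolding usc_on_def eventually_at_filter
    by (fastforce elim: eventually_mono)
  then have "\<forall>\<^sub>F n in sequentially. f (X n) < c"
    using X by (auto dest: filterlim_iff[THEN iffD1, rule_format])
  moreover have "\<forall>\<^sub>F n in sequentially. c < ereal (a n)"
    using a c(2) by (metis lim_ereal order_tendstoD(1))
  ultimately have "\<forall>\<^sub>F n in sequentially. False"
    by eventually_elim (use le in \<open>metis leD order_less_trans\<close>)
  then show False by simp
qed

theorem corollary1:
  fixes \<Omega> :: "('n::finite, 'm::finite) allocation set"
    and U V :: "('n, 'm) consumption \<Rightarrow> ereal"
  assumes "collective_model \<Omega> U V"
    and "feasible_allocations \<Omega>"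
    and "utility_functions \<Omega> U V"
    and "transferability \<Omega>"
    and "concave_cardinal_representation U V"
    and "vital_goods \<Omega> U V"
  shows "proper_bargaining_set (strict_utility_possibility_set \<Omega> U V) \<and>
    (\<forall>p \<in> frontier (strict_utility_possibility_set \<Omega> U V).
       strongly_pareto_efficient (strict_utility_possibility_set \<Omega> U V) p)"
proof -
  let ?H = "strict_utility_possibility_set \<Omega> U V"
  have nonneg: "0 \<le> qa" "0 \<le> qb" "0 \<le> Q" if "(qa, qb, Q) \<in> \<Omega>" for qa qb Q
    using assms(1) that by (auto simp: collective_model_def less_eq_prod_def)
  have Ufin: "\<forall>z\<ge>0. U z \<noteq> \<infinity>" and Vfin: "\<forall>z\<ge>0. V z \<noteq> \<infinity>"
    using assms(1) by (auto simp: collective_model_def)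
  have Uinc: "strictly_increasing_utility U" and Vinc: "strictly_increasing_utility V"
    and Uusc: "usc_on \<Omega> (\<lambda>(qa, qb, Q). U (qa, Q))"
    and Vusc: "usc_on \<Omega> (\<lambda>(qa, qb, Q). V (qb, Q))"
    using assms(3) by (auto simp: utility_functions_def)
  obtain i j where Uvital: "vital_for i U" and Vvital: "vital_for j V"
    and disposal: "\<And>qa qb Q x y. \<lbrakk>(qa, qb, Q) \<in> \<Omega>; 0 \<le> x; x \<le> qa $ i; 0 \<le> y; y \<le> qb $ j\<rbrakk>
      \<Longrightarrow> (set_coord qa i x, set_coord qb j y, Q) \<in> \<Omega>"
    using assms(6) unfolding vital_goods_def by fast
  have Uconc: "ereal_concave_on {z. 0 \<le> z} U" and Vconc: "ereal_concave_on {z. 0 \<le> z} V"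
    using assms(5) by (auto simp: concave_cardinal_representation_def)
  note U_attains = vital_good_attains_lower_level[OF Ufin Uinc Uconc Uvital]
  note V_attains = vital_good_attains_lower_level[OF Vfin Vinc Vconc Vvital]
  have finite_between: "\<exists>r. W z = ereal r \<and> w \<le> r"
    if "\<forall>z\<ge>0. W z \<noteq> \<infinity>" "0 \<le> z" "ereal w \<le> W z"
    for W :: "('n, 'm) consumption \<Rightarrow> ereal" and z w
  proof -
    have "W z \<noteq> \<infinity>" using that by blast
    with that(3) show ?thesis by (cases "W z") auto
  qed
  have H_eq: "(u, v) \<in> ?H \<longleftrightarrow>
      (\<exists>qa qb Q. (qa, qb, Q) \<in> \<Omega> \<and> U (qa, Q) = ereal u \<and> V (qb, Q) = ereal v)" for u v
    unfolding strict_utility_possibility_set_def by (fastforce simp: eq_commute)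
  \<comment> \<open>Inequalities replace the equalities of \<open>H_eq\<close> because upper
    semicontinuity preserves only lower bounds in the limit.\<close>
  have H_iff: "(u, v) \<in> ?H \<longleftrightarrow>
      (\<exists>qa qb Q. (qa, qb, Q) \<in> \<Omega> \<and> ereal u \<le> U (qa, Q) \<and> ereal v \<le> V (qb, Q))" for u v
  proof
    assume "(u, v) \<in> ?H"
    then show "\<exists>qa qb Q. (qa, qb, Q) \<in> \<Omega> \<and> ereal u \<le> U (qa, Q) \<and> ereal v \<le> V (qb, Q)"
      unfolding H_eq by (metis order_refl)
  next
    assume "\<exists>qa qb Q. (qa, qb, Q) \<in> \<Omega> \<and> ereal u \<le> U (qa, Q) \<and> ereal v \<le> V (qb, Q)"
    then obtain qa qb Q where \<omega>: "(qa, qb, Q) \<in> \<Omega>"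
      and uv: "ereal u \<le> U (qa, Q)" "ereal v \<le> V (qb, Q)" by blast
    note nn = nonneg[OF \<omega>]
    obtain u0 v0 where "U (qa, Q) = ereal u0" "u \<le> u0" "V (qb, Q) = ereal v0" "v \<le> v0"
      using finite_between[OF Ufin _ uv(1)] finite_between[OF Vfin _ uv(2)] nn
      by (auto simp: less_eq_prod_def)
    \<comment> \<open>Each utility depends on private goods of one person only, so the two vital
      goods can be lowered independently to reach \<open>u\<close> and \<open>v\<close>
      exactly.\<close>
    then obtain x y where "0 < x" "x \<le> qa $ i" "U (set_coord qa i x, Q) = ereal u"
      and "0 < y" "y \<le> qb $ j" "V (set_coord qb j y, Q) = ereal v"
      using U_attains[of qa Q u0 u] V_attains[of qb Q v0 v] nn by blast
    moreover from this have "(set_coord qa i x, set_coord qb j y, Q) \<in> \<Omega>"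
      using disposal[OF \<omega>] by simp
    ultimately show "(u, v) \<in> ?H"
      unfolding H_eq by blast
  qed
  have lower: "(u', v') \<in> ?H" if "(u, v) \<in> ?H" "u' \<le> u" "v' \<le> v" for u v u' v'
    using that unfolding H_iff by (meson ereal_less_eq(3) order_trans)
  have "closed ?H"
    unfolding closed_sequential_limits
  proof (intro allI impI, elim conjE)
    fix p :: "nat \<Rightarrow> real \<times> real" and l
    assume p: "\<forall>n. p n \<in> ?H" and l: "p \<longlonglongrightarrow> l"
    have "\<exists>\<omega>\<in>\<Omega>. ereal (fst (p n)) \<le> (\<lambda>(qa, qb, Q). U (qa, Q)) \<omega>
        \<and> ereal (snd (p n)) \<le> (\<lambda>(qa, qb, Q). V (qb, Q)) \<omega>" for n
      using p H_iff[of "fst (p n)" "snd (p n)"] by force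
    then obtain X where X: "\<And>n. X n \<in> \<Omega>"
      "\<And>n. ereal (fst (p n)) \<le> (\<lambda>(qa, qb, Q). U (qa, Q)) (X n)"
      "\<And>n. ereal (snd (p n)) \<le> (\<lambda>(qa, qb, Q). V (qb, Q)) (X n)"
      by metis
    \<comment> \<open>Compactness of \<open>\<Omega>\<close> gives a limit allocation, which will
      witness that \<open>l\<close> is dominated.\<close>
    obtain \<omega> r where \<omega>: "\<omega> \<in> \<Omega>" "strict_mono r" "(X \<circ> r) \<longlonglongrightarrow> \<omega>"
      using assms(2) X(1) unfolding feasible_allocations_def compact_def by metis
    have l': "(p \<circ> r) \<longlonglongrightarrow> l"
      using LIMSEQ_subseq_LIMSEQ[OF l \<omega>(2)] .
    have "ereal (fst l) \<le> (\<lambda>(qa, qb, Q). U (qa, Q)) \<omega>"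
      by (rule usc_on_ge_limit[OF Uusc \<omega>(3) _ \<omega>(1) tendsto_fst[OF l']]) (simp_all only: o_apply X)
    moreover have "ereal (snd l) \<le> (\<lambda>(qa, qb, Q). V (qb, Q)) \<omega>"
      by (rule usc_on_ge_limit[OF Vusc \<omega>(3) _ \<omega>(1) tendsto_snd[OF l']]) (simp_all only: o_apply X)
    ultimately have "(fst l, snd l) \<in> ?H"
      using \<omega>(1) unfolding H_iff by (cases \<omega>) auto
    then show "l \<in> ?H" by simp
  qed
  moreover have "?H \<noteq> {}"
  proof -
    obtain qa qb Q where \<omega>: "(qa, qb, Q) \<in> \<Omega>" "U (qa, Q) \<noteq> -\<infinity>" "V (qb, Q) \<noteq> -\<infinity>"
      using assms(1) unfolding collective_model_def by blast
    moreover have "U (qa, Q) \<noteq> \<infinity>" "V (qb, Q) \<noteq> \<infinity>"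
      using Ufin Vfin nonneg[OF \<omega>(1)] by (auto simp: less_eq_prod_def)
    ultimately obtain u v where "ereal u = U (qa, Q)" "ereal v = V (qb, Q)"
      by (metis ereal_cases)
    with \<omega>(1) have "(u, v) \<in> ?H"
      unfolding H_iff by (metis order_refl)
    then show ?thesis by blast
  qed
  moreover have "bargaining_bounded_above ?H"
  proof -
    have "\<exists>M. \<forall>(u, v)\<in>?H. u \<le> M \<and> v \<le> M"
    proof -
      obtain A B where "\<forall>(qa, qb, Q)\<in>\<Omega>. U (qa, Q) \<le> ereal A"
        and "\<forall>(qa, qb, Q)\<in>\<Omega>. V (qb, Q) \<le> ereal B"
        using assms(3) unfolding utility_functions_def bounded_above_on_def by fast
      then have "\<forall>(u, v)\<in>?H. u \<le> max A B \<and> v \<le> max A B"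
        by (fastforce simp: strict_utility_possibility_set_def le_max_iff_disj
            simp flip: ereal_less_eq(3))
      then show ?thesis ..
    qed
    then obtain M where M: "u \<le> M" "v \<le> M" if "(u, v) \<in> ?H" for u v
      by fast
    have "\<exists>N. \<forall>n\<ge>N. M < w n" if "filterlim w at_top sequentially" for w :: "nat \<Rightarrow> real"
      using that by (simp add: filterlim_at_top_dense eventually_sequentially)
    then show ?thesis
      unfolding bargaining_bounded_above_def by (meson M leD)
  qed
  moreover have "strongly_pareto_efficient ?H p" if "p \<in> frontier ?H" for p
  proof -
    \<comment> \<open>The open quadrant strictly below a point of the set lies in the set.\<close>
    have interior: "(u, v) \<in> interior ?H" if "(u', v') \<in> ?H" "u < u'" "v < v'" for u v u' v'
    proof (rule interiorI)
      show "open ({..<u'} \<times> {..<v'})" by (simp add: open_Times)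
      show "{..<u'} \<times> {..<v'} \<subseteq> ?H" using lower[OF that(1)] by auto
    qed (use that in auto)
    \<comment> \<open>Part of the strict surplus in \<open>u\<close> is traded for a strict gain in
      \<open>v\<close>, which reduces the claim to \<open>interior\<close>.\<close>
    have raise_V: "(u, v) \<in> interior ?H" if uv: "(u', v') \<in> ?H" "u < u'" "v \<le> v'" for u v u' v'
    proof -
      obtain qa qb Q where \<omega>: "(qa, qb, Q) \<in> \<Omega>" "U (qa, Q) = ereal u'" "V (qb, Q) = ereal v'"
        using uv(1) unfolding H_eq by blast
      note nn = nonneg[OF \<omega>(1)]
      \<comment> \<open>Stopping at \<open>m\<close> leaves the man strictly above \<open>u\<close>
        after his sacrifice; \<open>m < u'\<close> forces him to give up a positive amount of good
        \<open>i\<close>, as transferability requires.\<close>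
      obtain m where m: "u < m" "m < u'" using dense uv(2) by blast
      obtain x where x: "0 < x" "x \<le> qa $ i" "U (set_coord qa i x, Q) = ereal m"
        using U_attains[OF nn(1,3) \<omega>(2)] m by (meson less_imp_le)
      then have "x < qa $ i" using \<omega>(2) m by (cases "x = qa $ i") auto
      \<comment> \<open>Disposal with the woman's vital good kept at \<open>qb $ j\<close> changes
        only the man's bundle.\<close>
      moreover have "(set_coord qa i x, qb, Q) \<in> \<Omega>"
        using disposal[OF \<omega>(1), of x "qb $ j"] x nn by (simp add: less_eq_vec_def)
      ultimately obtain l y where y: "qb $ l < y" "(set_coord qa i x, set_coord qb l y, Q) \<in> \<Omega>"
        using assms(4) \<omega>(1) order_less_trans[OF x(1)] unfolding transferability_def
        by blast
      \<comment> \<open>Transferability chooses the good \<open>l\<close>; utility is strictly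
        increasing in every good, so she gains whichever it is.\<close>
      have "ereal v' < V (set_coord qb l y, Q)"
        using strictly_increasing_utility_strict[OF Vinc nn(2,3) y(1)] \<omega>(3) by simp
      then obtain v'' where "v' < v''" "ereal v'' \<le> V (set_coord qb l y, Q)"
        using ereal_dense2 by (metis less_ereal.simps(1) less_imp_le)
      then have "(m, v'') \<in> ?H"
        using y(2) x(3) unfolding H_iff by (metis order_refl)
      then show ?thesis
        using interior m \<open>v' < v''\<close> uv(3) by (meson order_le_less_trans)
    qed
    \<comment> \<open>The same trade with the roles exchanged: the woman gives up some of good
      \<open>j\<close>.\<close>
    have raise_U: "(u, v) \<in> interior ?H" if uv: "(u', v') \<in> ?H" "u \<le> u'" "v < v'" for u v u' v'
    proof -
      obtain qa qb Q where \<omega>: "(qa, qb, Q) \<in> \<Omega>" "U (qa, Q) = ereal u'" "V (qb, Q) = ereal v'"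
        using uv(1) unfolding H_eq by blast
      note nn = nonneg[OF \<omega>(1)]
      obtain m where m: "v < m" "m < v'" using dense uv(3) by blast
      obtain x where x: "0 < x" "x \<le> qb $ j" "V (set_coord qb j x, Q) = ereal m"
        using V_attains[OF nn(2,3) \<omega>(3)] m by (meson less_imp_le)
      then have "x < qb $ j" using \<omega>(3) m by (cases "x = qb $ j") auto
      moreover have "(qa, set_coord qb j x, Q) \<in> \<Omega>"
        using disposal[OF \<omega>(1), of "qa $ i" x] x nn by (simp add: less_eq_vec_def)
      ultimately obtain l y where y: "qa $ l < y" "(set_coord qa l y, set_coord qb j x, Q) \<in> \<Omega>"
        using assms(4) \<omega>(1) order_less_trans[OF x(1)] unfolding transferability_def
        by blast
      have "ereal u' < U (set_coord qa l y, Q)"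
        using strictly_increasing_utility_strict[OF Uinc nn(1,3) y(1)] \<omega>(2) by simp
      then obtain u'' where "u' < u''" "ereal u'' \<le> U (set_coord qa l y, Q)"
        using ereal_dense2 by (metis less_ereal.simps(1) less_imp_le)
      then have "(u'', m) \<in> ?H"
        using y(2) x(3) unfolding H_iff by (metis order_refl)
      then show ?thesis
        using interior m \<open>u' < u''\<close> uv(2) by (meson order_le_less_trans)
    qed
    \<comment> \<open>Closedness puts the boundary point in the set. A point dominating it would
      make it interior, by \<open>raise_V\<close> if \<open>u\<close> is strictly higher and by
      \<open>raise_U\<close> if \<open>v\<close> is.\<close>
    have "p \<in> ?H" "p \<notin> interior ?H"
      using that \<open>closed ?H\<close> by (auto simp: frontier_def)
    then show ?thesis
      unfolding strongly_pareto_efficient_def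
      using raise_U[of _ _ "fst p" "snd p"] raise_V[of _ _ "fst p" "snd p"] by auto
  qed
  ultimately show ?thesis
    using lower unfolding proper_bargaining_set_def lower_comprehensive_def by blast
qed

end
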